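(* For the rhombus game on the triangular grid with $n$ winning sets, $\mathrm{SC}_2(\mathcal G_{\lozenge},3)\ge \frac{7n}{96}-o(n)$.
   Context: An $s$-of-$k$ game on a $k$-uniform hypergraph $(V,\mathcal F)$ (winning sets are $k$-element subsets of the finite set $V$), $1\le s\le k$: Maker and Breaker alternately claim unclaimed vertices, Maker first, until all are claimed; the score is the number of winning sets in which Maker claimed at least $s$ vertices (Maker maximizes, Breaker minimizes). A pairing strategy for Maker: she fixes in advance pairwise disjoint pairs of vertices and, whenever Breaker claims a vertex of a pair whose partner is unclaimed, she claims the partner (other moves arbitrary). $\mathrm{SC}_2(\mathcal H,s)$ is the largest score Maker can guarantee against every Breaker strategy using a pairing strategy. $\mathcal G_{\lozenge}$ is the hypergraph whose vertices are the points of a finite portion of the triangular lattice and whose winning sets are the vertex sets of all rhombi formed by two unit triangles sharing an edge, in all three orientations, so $k=4$. Grids are assumed "two-dimensional": the number of winning sets within constant distance of the boundary is $o(n)$, where $n$ is the number of winning sets; $o(n)$ refers to $n\to\infty$. *)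

theory Defs
  imports Complex_Main "HOL-Library.Disjoint_Sets" "HOL-Library.Landau_Symbols"
begin

section \<open>Scoring games and pairing strategies\<close>

text \<open>
  A history is the list of vertices claimed so far, in order of play.  Maker moves first, so the
  vertices at even (0-based) positions are Maker's.  A strategy maps histories to vertices; only its
  values on histories of the appropriate parity matter.
\<close>

definition unfinished :: "'a set \<Rightarrow> 'a list \<Rightarrow> bool" where
  "unfinished V h \<longleftrightarrow> distinct h \<and> set h \<subset> V"

definition maker_strategy :: "'a set \<Rightarrow> ('a list \<Rightarrow> 'a) \<Rightarrow> bool" where
  "maker_strategy V \<sigma> \<longleftrightarrow> (\<forall>h. unfinished V h \<and> even (length h) \<longrightarrow> \<sigma> h \<in> V - set h)"

definition breaker_strategy :: "'a set \<Rightarrow> ('a list \<Rightarrow> 'a) \<Rightarrow> bool" where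
  "breaker_strategy V \<tau> \<longleftrightarrow> (\<forall>h. unfinished V h \<and> odd (length h) \<longrightarrow> \<tau> h \<in> V - set h)"

primrec play :: "('a list \<Rightarrow> 'a) \<Rightarrow> ('a list \<Rightarrow> 'a) \<Rightarrow> nat \<Rightarrow> 'a list" where
  "play \<sigma> \<tau> 0 = []"
| "play \<sigma> \<tau> (Suc t) = play \<sigma> \<tau> t @ [(if even t then \<sigma> else \<tau>) (play \<sigma> \<tau> t)]"

definition maker_vertices :: "'a list \<Rightarrow> 'a set" where
  "maker_vertices h = {h ! i | i. i < length h \<and> even i}"

definition score :: "'a set set \<Rightarrow> nat \<Rightarrow> 'a list \<Rightarrow> nat" where
  "score F s h = card {W \<in> F. s \<le> card (W \<inter> maker_vertices h)}"

definition pairing :: "'a set \<Rightarrow> 'a set set \<Rightarrow> bool" where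
  "pairing V P \<longleftrightarrow> (\<forall>e\<in>P. e \<subseteq> V \<and> card e = 2) \<and> disjoint P"

definition pairing_strategy :: "'a set \<Rightarrow> 'a set set \<Rightarrow> ('a list \<Rightarrow> 'a) \<Rightarrow> bool" where
  "pairing_strategy V P \<sigma> \<longleftrightarrow> maker_strategy V \<sigma> \<and>
     (\<forall>h x y. unfinished V (h @ [x]) \<and> even (length (h @ [x])) \<and>
        {x, y} \<in> P \<and> y \<notin> set (h @ [x]) \<longrightarrow> \<sigma> (h @ [x]) = y)"

text \<open>
  The moves of Maker that are not dictated by the pairing are arbitrary, so the score has to be
  guaranteed by the pairs alone: it must be reached by \<^emph>\<open>every\<close> \<open>\<sigma>\<close> that obeys the pairing.
  (With \<open>\<exists>\<sigma>\<close> instead, the empty pairing would admit all strategies of Maker, and the restriction to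
  pairing strategies would be void.)
\<close>

definition pairing_guarantees :: "'a set \<Rightarrow> 'a set set \<Rightarrow> nat \<Rightarrow> 'a set set \<Rightarrow> nat \<Rightarrow> bool" where
  "pairing_guarantees V F s P m \<longleftrightarrow>
     (\<forall>\<sigma> \<tau>. pairing_strategy V P \<sigma> \<and> breaker_strategy V \<tau> \<longrightarrow>
        m \<le> score F s (play \<sigma> \<tau> (card V)))"

definition SC2 :: "'a set \<Rightarrow> 'a set set \<Rightarrow> nat \<Rightarrow> nat" where
  "SC2 V F s = Max {m. \<exists>P. pairing V P \<and> pairing_guarantees V F s P m}"

section \<open>Rhombi in the triangular lattice\<close>

text \<open>
  The lattice point with coordinates \<open>(a, b)\<close> is \<open>a + b \<omega>\<close> in the complex plane, where
  \<open>\<omega>\<close> is the primitive sixth root of unity; vertices are represented by their coordinates.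
\<close>

type_synonym lattice_point = "int \<times> int"

definition plane_point :: "lattice_point \<Rightarrow> complex" where
  "plane_point p = of_int (fst p) + of_int (snd p) * cis (pi / 3)"

definition lattice_dist :: "lattice_point \<Rightarrow> lattice_point \<Rightarrow> real" where
  "lattice_dist p q = dist (plane_point p) (plane_point q)"

definition unit_triangle :: "lattice_point set \<Rightarrow> bool" where
  "unit_triangle T \<longleftrightarrow> card T = 3 \<and> (\<forall>p\<in>T. \<forall>q\<in>T. p \<noteq> q \<longrightarrow> lattice_dist p q = 1)"

definition rhombus :: "lattice_point set \<Rightarrow> bool" where
  "rhombus W \<longleftrightarrow> (\<exists>S T. unit_triangle S \<and> unit_triangle T \<and> card (S \<inter> T) = 2 \<and> W = S \<union> T)"

definition rhombi :: "lattice_point set \<Rightarrow> lattice_point set set" where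
  "rhombi V = {W. rhombus W \<and> W \<subseteq> V}"

definition boundary :: "lattice_point set \<Rightarrow> lattice_point set" where
  "boundary V = {p \<in> V. \<exists>q. q \<notin> V \<and> lattice_dist p q = 1}"

definition rhombi_near_boundary :: "lattice_point set \<Rightarrow> real \<Rightarrow> lattice_point set set" where
  "rhombi_near_boundary V d = {W \<in> rhombi V. \<exists>p\<in>W. \<exists>q\<in>boundary V. lattice_dist p q \<le> d}"

text \<open>
  ``Two-dimensional'' is a property of a growing family of finite portions of the lattice: for every
  fixed distance, all but a vanishing fraction of the winning sets are further from the boundary.
\<close>

definition two_dimensional :: "(nat \<Rightarrow> lattice_point set) \<Rightarrow> bool" where
  "two_dimensional V \<longleftrightarrow>
     (\<forall>d. (\<lambda>i. real (card (rhombi_near_boundary (V i) d))) \<in> o(\<lambda>i. real (card (rhombi (V i)))))"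

end

theory Submission
  imports Defs "HOL-Library.Product_Plus"
begin

text \<open>
  The lattice is tiled by translates of a tile of 14 points, carrying 7 pairs, under the sublattice
  of index 14 generated by (14, 0) and (3, 1).  The pairing strategy secures a point of every pair,
  and each of the \<open>2\<^sup>7\<close> ways to choose one point per pair meets at least 4 of 18
  rhombi inside the tile in 3 or more points.  Attributing every rhombus to a translate so that each
  receives at most \<open>3 * 14 = 42\<close>, all but those near the boundary belong to a translate inside the
  board.  So Maker scores \<open>4 n / 42 - o(n)\<close>, and \<open>4 / 42 > 7 / 96\<close>.
\<close>

section \<open>Pairing strategies\<close>

lemma play_extends: "t \<le> t' \<Longrightarrow> \<exists>ys. play \<sigma> \<tau> t' = play \<sigma> \<tau> t @ ys"
proof (induction t')
  case (Suc t')
  then show ?case by (cases "t = Suc t'") auto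
qed simp

lemma length_play [simp]: "length (play \<sigma> \<tau> t) = t"
  by (induction t) auto

lemma play_nth: "t < t' \<Longrightarrow> play \<sigma> \<tau> t' ! t = (if even t then \<sigma> else \<tau>) (play \<sigma> \<tau> t)"
  using play_extends[of "Suc t" t' \<sigma> \<tau>] by (auto simp: nth_append)

lemma unfinished_iff_length:
  assumes "finite V" "distinct h" "set h \<subseteq> V"
  shows "unfinished V h \<longleftrightarrow> length h < card V"
  using assms unfolding unfinished_def
  by (metis card_subset_eq distinct_card less_irrefl psubset_card_mono psubsetI)

lemma play_legal:
  assumes "finite V" "maker_strategy V \<sigma>" "breaker_strategy V \<tau>" "t \<le> card V"
  shows "distinct (play \<sigma> \<tau> t) \<and> set (play \<sigma> \<tau> t) \<subseteq> V"
  using assms(4)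
proof (induction t)
  case (Suc t)
  then have "unfinished V (play \<sigma> \<tau> t)"
    using unfinished_iff_length[OF assms(1)] by simp
  then have "(if even t then \<sigma> else \<tau>) (play \<sigma> \<tau> t) \<in> V - set (play \<sigma> \<tau> t)"
    using assms(2,3) by (simp add: maker_strategy_def breaker_strategy_def)
  then show ?case using Suc by auto
qed simp

text \<open>If Breaker held both points of a pair, the strategy would have answered his first one
  with the other on Maker's very next move, so he could not have claimed it later.\<close>

lemma pairing_strategy_hits_pair:
  assumes fin: "finite V" and P: "pairing V P"
    and \<sigma>: "pairing_strategy V P \<sigma>" and \<tau>: "breaker_strategy V \<tau>" and e: "e \<in> P"
  shows "e \<inter> maker_vertices (play \<sigma> \<tau> (card V)) \<noteq> {}"
proof
  let ?h = "play \<sigma> \<tau> (card V)"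
  assume miss: "e \<inter> maker_vertices ?h = {}"
  have ms: "maker_strategy V \<sigma>" using \<sigma> by (simp add: pairing_strategy_def)
  have legal: "distinct (play \<sigma> \<tau> t) \<and> set (play \<sigma> \<tau> t) \<subseteq> V" if "t \<le> card V" for t
    using play_legal[OF fin ms \<tau> that] .
  have reply: "\<sigma> (h @ [x]) = y"
    if "unfinished V (h @ [x])" "even (length (h @ [x]))" "{x, y} \<in> P" "y \<notin> set (h @ [x])"
    for h x y
    using \<sigma> that by (simp add: pairing_strategy_def)
  have "set ?h = V"
    using legal[of "card V"] fin by (metis card_subset_eq distinct_card length_play order_refl)
  moreover have "e \<subseteq> V" "card e = 2"
    using P e by (auto simp: pairing_def)
  ultimately obtain x y where xy: "e = {x, y}" "x \<noteq> y" "x \<in> set ?h" "y \<in> set ?h"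
    by (metis card_2_iff insert_subset)
  \<comment> \<open>Pairs are unordered, so the contradiction is derived for the order of play and
    used for both orders of indices. The dictated reply sits at position \<open>Suc i\<close>, and
    distinctness gives \<open>j = Suc i\<close>, although \<open>i\<close> and \<open>j\<close> are
    both odd.\<close>
  have ordered: False if "i < j" "j < card V" "e = {?h ! i, ?h ! j}" for i j
  proof -
    have odd: "odd i" "odd j"
      using miss that by (auto simp: maker_vertices_def)
    let ?g = "play \<sigma> \<tau> i @ [?h ! i]"
    have g: "?g = play \<sigma> \<tau> (Suc i)"
      using that odd by (simp add: play_nth)
    have "Suc i \<le> card V" using that by simp
    from play_extends[OF this] obtain ys where ys: "?h = ?g @ ys"
      unfolding g by blast
    have unf: "unfinished V ?g"
      using unfinished_iff_length[OF fin] legal[of "Suc i"] that unfolding g by simp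
    have "distinct ?h" using legal by simp
    then have "?h ! j \<notin> set (take (Suc i) ?h)"
      using that(1,2) by (auto simp: in_set_conv_nth nth_eq_iff_index_eq)
    moreover have "take (Suc i) ?h = ?g"
      by (subst ys) simp
    ultimately have "?h ! j \<notin> set ?g" by metis
    moreover have "even (length ?g)" using odd by simp
    moreover have "{?h ! i, ?h ! j} \<in> P" using e that(3) by simp
    ultimately have "\<sigma> ?g = ?h ! j"
      using unf reply by blast
    moreover have "?h ! Suc i = \<sigma> ?g"
      using that odd g by (simp add: play_nth)
    ultimately have eq: "?h ! j = ?h ! Suc i"
      by (simp only:)
    have "distinct ?h" "j < length ?h" "Suc i < length ?h"
      using legal[of "card V"] that(1,2) by simp_all
    then have "j = Suc i"
      using eq by (simp only: nth_eq_iff_index_eq)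
    with odd show False by simp
  qed
  obtain i where i: "i < card V" "x = ?h ! i"
    using xy(3) by (metis in_set_conv_nth length_play)
  obtain j where j: "j < card V" "y = ?h ! j"
    using xy(4) by (metis in_set_conv_nth length_play)
  have "e = {?h ! i, ?h ! j}" "e = {?h ! j, ?h ! i}"
    using xy(1) i(2) j(2) by auto
  moreover have "i < j \<or> j < i"
    using xy(2) i(2) j(2) by (metis nat_neq_iff)
  ultimately show False
    using ordered i(1) j(1) by blast
qed

text \<open>Keeps \<open>pairing_guarantees\<close> from holding vacuously for every
  \<open>m\<close>, which would leave the set under \<open>Max\<close> in \<open>SC2\<close>
  infinite. Disjointness of the pairs makes the dictated reply unique.\<close>

lemma pairing_strategy_exists:
  assumes "pairing V P"
  shows "\<exists>\<sigma>. pairing_strategy V P \<sigma>"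
proof -
  define reply where "reply h y \<longleftrightarrow> h \<noteq> [] \<and> {last h, y} \<in> P \<and> y \<notin> set h" for h y
  define \<sigma> where "\<sigma> h = (if \<exists>y. reply h y then SOME y. reply h y else SOME v. v \<in> V - set h)" for h
  have mem: "y \<in> V" if "reply h y" for h y
    using that assms by (auto simp: reply_def pairing_def)
  have unique: "y = y'" if "reply h y" "reply h y'" for h y y'
  proof -
    have "{last h, y} = {last h, y'}"
      using that assms disjointD[of P "{last h, y}" "{last h, y'}"]
      by (auto simp: reply_def pairing_def)
    then show ?thesis
      using that by (auto simp: doubleton_eq_iff)
  qed
  have "\<sigma> h \<in> V - set h" if "unfinished V h" for h
  proof (cases "\<exists>y. reply h y")
    case True
    then have "reply h (\<sigma> h)"
      unfolding \<sigma>_def by (simp add: someI_ex)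
    then show ?thesis using mem by (auto simp: reply_def)
  next
    case False
    have "\<exists>v. v \<in> V - set h"
      using that by (auto simp: unfinished_def)
    then have "(SOME v. v \<in> V - set h) \<in> V - set h"
      by (rule someI_ex)
    then show ?thesis
      using False by (simp add: \<sigma>_def)
  qed
  moreover have "\<sigma> (h @ [x]) = y" if "{x, y} \<in> P" "y \<notin> set (h @ [x])" for h x y
  proof -
    have r: "reply (h @ [x]) y"
      using that by (simp add: reply_def)
    then have "reply (h @ [x]) (\<sigma> (h @ [x]))"
      unfolding \<sigma>_def using someI_ex[of "reply (h @ [x])"] by auto
    then show ?thesis using unique r by blast
  qed
  ultimately show ?thesis
    by (intro exI[of _ \<sigma>]) (simp add: pairing_strategy_def maker_strategy_def)
qed

lemma breaker_strategy_exists: "\<exists>\<tau>. breaker_strategy V \<tau>"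
proof -
  have "(SOME v. v \<in> V - set h) \<in> V - set h" if "unfinished V h" for h
  proof (rule someI_ex)
    show "\<exists>v. v \<in> V - set h"
      using that by (auto simp: unfinished_def)
  qed
  then show ?thesis
    by (intro exI[of _ "\<lambda>h. SOME v. v \<in> V - set h"]) (simp add: breaker_strategy_def)
qed

lemma SC2_ge:
  assumes "finite F" "pairing V P" "pairing_guarantees V F s P m"
  shows "m \<le> SC2 V F s"
  unfolding SC2_def
proof (rule Max_ge)
  \<comment> \<open>\<open>Max\<close> requires a finite set. Every guaranteed value is bounded by
    the score of some actual play, hence by the number of winning sets.\<close>
  have "k \<le> card F" if P: "pairing V P" "pairing_guarantees V F s P k" for P k
  proof -
    obtain \<sigma> \<tau> where "pairing_strategy V P \<sigma>" "breaker_strategy V \<tau>"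
      using pairing_strategy_exists[OF P(1)] breaker_strategy_exists by blast
    then have "k \<le> score F s (play \<sigma> \<tau> (card V))"
      using P(2) by (auto simp: pairing_guarantees_def)
    also have "\<dots> \<le> card F"
      unfolding score_def by (rule card_mono[OF assms(1)]) auto
    finally show ?thesis .
  qed
  then show "finite {m. \<exists>P. pairing V P \<and> pairing_guarantees V F s P m}"
    by (auto simp: finite_nat_set_iff_bounded_le)
qed (use assms in blast)

section \<open>Coordinates of rhombi\<close>

text \<open>The form is the norm of an Eisenstein integer; squaring turns the question of unit
  distance into an integer equation.\<close>

lemma norm_plane_point_sq:
  "(norm (plane_point p))\<^sup>2 = of_int ((fst p)\<^sup>2 + fst p * snd p + (snd p)\<^sup>2)"
proof -
  have "Re (plane_point p) = fst p + snd p / 2" "Im (plane_point p) = snd p * sqrt 3 / 2"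
    by (simp_all add: plane_point_def cos_60 sin_60)
  then have "(norm (plane_point p))\<^sup>2 = (fst p + snd p / 2)\<^sup>2 + (snd p * sqrt 3 / 2)\<^sup>2"
    by (simp only: cmod_power2)
  also have "\<dots> = of_int ((fst p)\<^sup>2 + fst p * snd p + (snd p)\<^sup>2)"
    by (simp add: power_mult_distrib power_divide power2_sum field_simps)
  finally show ?thesis .
qed

lemma plane_point_diff: "plane_point (p - q) = plane_point p - plane_point q"
  by (simp add: plane_point_def algebra_simps)

lemma lattice_dist_eq_norm: "lattice_dist p q = norm (plane_point (q - p))"
  by (simp add: lattice_dist_def plane_point_diff dist_norm norm_minus_commute)

text \<open>The six units of the Eisenstein integers, in steps of 60 degrees.\<close>

definition unit_vectors :: "lattice_point set" where
  "unit_vectors = {(1, 0), (0, 1), (-1, 1), (-1, 0), (0, -1), (1, -1)}"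

lemma eisenstein_norm_one_iff:
  fixes a b :: int
  shows "a\<^sup>2 + a * b + b\<^sup>2 = 1 \<longleftrightarrow> (a, b) \<in> unit_vectors"
proof
  assume *: "a\<^sup>2 + a * b + b\<^sup>2 = 1"
  \<comment> \<open>Multiplying by four and completing the square in either variable bounds both
    coordinates by 1 in absolute value.\<close>
  have "(2 * a + b)\<^sup>2 + 3 * b\<^sup>2 = 4" "(a + 2 * b)\<^sup>2 + 3 * a\<^sup>2 = 4"
    using * by (simp_all add: power2_eq_square algebra_simps)
  then have "3 * b\<^sup>2 \<le> 4" "3 * a\<^sup>2 \<le> 4"
    by (smt (verit) zero_le_power2)+
  then have "b\<^sup>2 \<le> 1\<^sup>2" "a\<^sup>2 \<le> 1\<^sup>2" by simp_all
  then have "\<bar>b\<bar> \<le> 1" "\<bar>a\<bar> \<le> 1"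
    by (simp_all add: abs_le_square_iff[of _ 1, simplified])
  then have "a \<in> {-1, 0, 1}" "b \<in> {-1, 0, 1}" by auto
  then show "(a, b) \<in> unit_vectors"
    using * by (auto simp: unit_vectors_def)
qed (auto simp: unit_vectors_def)

lemma lattice_dist_one_iff: "lattice_dist p q = 1 \<longleftrightarrow> q - p \<in> unit_vectors"
proof -
  have "lattice_dist p q = 1 \<longleftrightarrow> (norm (plane_point (q - p)))\<^sup>2 = 1"
    unfolding lattice_dist_eq_norm by (simp add: power2_eq_1_iff) (smt (verit) norm_ge_zero)
  also have "\<dots> \<longleftrightarrow> q - p \<in> unit_vectors"
    unfolding norm_plane_point_sq of_int_eq_1_iff eisenstein_norm_one_iff prod.collapse ..
  finally show ?thesis .
qed

lemma norm_plane_point_le: "norm (plane_point p) \<le> of_int (\<bar>fst p\<bar> + \<bar>snd p\<bar>)"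
  unfolding plane_point_def by (rule order_trans[OF norm_triangle_ineq]) (simp add: norm_mult)

lemma lattice_dist_le: "lattice_dist p q \<le> of_int (\<bar>fst q - fst p\<bar> + \<bar>snd q - snd p\<bar>)"
  using norm_plane_point_le[of "q - p"] by (simp add: lattice_dist_eq_norm)

text \<open>
  The rhombus with short diagonal from \<open>q\<close> to \<open>q + u\<close>: its other two vertices are \<open>q\<close> plus the
  rotations of \<open>u\<close> by 60 degrees either way.
\<close>

definition diamond :: "lattice_point \<times> lattice_point \<Rightarrow> lattice_point list" where
  "diamond = (\<lambda>((x, y), (a, b)).
     [(x, y), (x + a, y + b), (x - b, y + a + b), (x + a + b, y - a)])"

text \<open>One vector from each opposite pair of units, since reversing the short diagonal gives
  the same rhombus. These are the three orientations.\<close>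

definition directions :: "lattice_point set" where
  "directions = {(1, 0), (0, 1), (-1, 1)}"

lemma rhombus_diamond:
  assumes "u \<in> directions"
  shows "rhombus (set (diamond (q, u)))"
proof -
  obtain x y a b where [simp]: "q = (x, y)" "u = (a, b)" by (cases q, cases u)
  let ?S = "{(x, y), (x + a, y + b), (x - b, y + a + b)}"
  let ?T = "{(x, y), (x + a, y + b), (x + a + b, y - a)}"
  consider "a = 1" "b = 0" | "a = 0" "b = 1" | "a = -1" "b = 1"
    using assms by (auto simp: directions_def)
  then have "unit_triangle ?S \<and> unit_triangle ?T \<and> card (?S \<inter> ?T) = 2"
    by cases (simp_all add: unit_triangle_def lattice_dist_one_iff unit_vectors_def)
  moreover have "set (diamond (q, u)) = ?S \<union> ?T"
    by (auto simp: diamond_def)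
  ultimately show ?thesis
    unfolding rhombus_def by blast
qed

lemma unit_triangle_apex:
  assumes "unit_triangle T" "q \<in> T" "r \<in> T" "q \<noteq> r"
  obtains p where "T = {q, r, p}" "r - q \<in> unit_vectors" "p - q \<in> unit_vectors" "p - r \<in> unit_vectors"
proof -
  have "card T = 3" using assms by (simp add: unit_triangle_def)
  then have "card (T - {q, r}) = 1"
    using assms by (subst card_Diff_subset) auto
  then obtain p where p: "T - {q, r} = {p}"
    by (auto simp: card_1_singleton_iff)
  then have "T = {q, r, p}" "p \<in> T" "p \<noteq> q" "p \<noteq> r"
    using assms by auto
  then show ?thesis
    using that assms unfolding unit_triangle_def lattice_dist_one_iff by metis
qed

text \<open>The edge \<open>u\<close> carries exactly two unit triangles, with third vertices at
  \<open>u\<close> turned by 60 degrees either way. The six by six cases are enumerated.\<close>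

lemma apex_cases:
  assumes "u \<in> unit_vectors" "v \<in> unit_vectors" "v - u \<in> unit_vectors"
  shows "v = (- snd u, fst u + snd u) \<or> v = (fst u + snd u, - fst u)"
proof -
  have "\<forall>u\<in>unit_vectors. \<forall>v\<in>unit_vectors. v - u \<in> unit_vectors \<longrightarrow>
      v = (- snd u, fst u + snd u) \<or> v = (fst u + snd u, - fst u)"
    by (simp add: unit_vectors_def prod_eq_iff)
  then show ?thesis using assms by blast
qed

lemma rhombus_eq_diamond:
  assumes "rhombus W"
  shows "\<exists>q. \<exists>u\<in>directions. W = set (diamond (q, u))"
proof -
  obtain S T where ST: "unit_triangle S" "unit_triangle T" "card (S \<inter> T) = 2" "W = S \<union> T"
    using assms by (auto simp: rhombus_def)
  obtain q r where qr: "S \<inter> T = {q, r}" "q \<noteq> r"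
    using ST(3) by (auto simp: card_2_iff)
  obtain p where p: "S = {q, r, p}" "r - q \<in> unit_vectors" "p - q \<in> unit_vectors" "p - r \<in> unit_vectors"
    using unit_triangle_apex[OF ST(1), of q r] qr by blast
  obtain p' where p': "T = {q, r, p'}" "p' - q \<in> unit_vectors" "p' - r \<in> unit_vectors"
    using unit_triangle_apex[OF ST(2), of q r] qr by blast
  \<comment> \<open>A common third vertex would lie in \<open>S \<inter> T = {q, r}\<close>, leaving
    \<open>S\<close> with only two points. Being distinct, the two apexes exhaust the two options of
    \<open>apex_cases\<close>.\<close>
  have "p \<noteq> p'"
    using qr p(1) p'(1) ST(1) by (auto simp: unit_triangle_def card_insert_if split: if_splits)
  have shift: "z - r = z - q - (r - q)" for z by simp
  obtain x y where q: "q = (x, y)" by (cases q)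
  obtain a b where ab: "r - q = (a, b)" by (cases "r - q")
  then have r: "r = (x + a, y + b)"
    using q by (cases r) auto
  have u: "(a, b) \<in> unit_vectors" using p ab by simp
  have "p - q = (- b, a + b) \<or> p - q = (a + b, - a)"
    "p' - q = (- b, a + b) \<or> p' - q = (a + b, - a)"
    using p(3,4) p'(2,3) unfolding shift ab by (simp_all only: apex_cases[OF u, simplified])
  then have "{p, p'} = {q + (- b, a + b), q + (a + b, - a)}"
    using \<open>p \<noteq> p'\<close> unfolding diff_eq_eq by (auto simp: add.commute)
  moreover have "W = {q, r} \<union> {p, p'}"
    using ST(4) p(1) p'(1) by blast
  ultimately have W: "W = set (diamond ((x, y), (a, b)))"
    by (simp add: diamond_def q r algebra_simps insert_commute)
  show ?thesis
  proof (cases "(a, b) \<in> directions")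
    case True
    then show ?thesis using W by blast
  next
    case False
    then have "(- a, - b) \<in> directions"
      using u by (auto simp: directions_def unit_vectors_def)
    moreover have "W = set (diamond ((x + a, y + b), (- a, - b)))"
      unfolding W by (auto simp: diamond_def)
    ultimately show ?thesis by blast
  qed
qed

section \<open>Finite boards and the distance to their boundary\<close>

lemma finite_rhombi: "finite V \<Longrightarrow> finite (rhombi V)"
  unfolding rhombi_def by (rule finite_subset[of _ "Pow V"]) auto

text \<open>Walk from \<open>q\<close> towards \<open>p\<close> by horizontal, then vertical unit
  steps: the first point met inside \<open>V\<close> has its predecessor outside and so is a
  boundary point. The induction is on the coordinate distance, which bounds
  \<open>lattice_dist\<close>.\<close>

lemma boundary_between:
  fixes p q :: lattice_point
  assumes "p \<in> V" "q \<notin> V"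
  shows "\<exists>b\<in>boundary V. lattice_dist p b \<le> of_int (\<bar>fst q - fst p\<bar> + \<bar>snd q - snd p\<bar>)"
  using assms
proof (induction "nat (\<bar>fst q - fst p\<bar> + \<bar>snd q - snd p\<bar>)" arbitrary: q)
  case 0
  then have "\<bar>fst q - fst p\<bar> + \<bar>snd q - snd p\<bar> \<le> 0" by simp
  then have "p = q" by (intro prod_eqI) linarith+
  then show ?case using 0 by simp
next
  case (Suc n)
  define s where "s = (if fst q \<noteq> fst p then (sgn (fst p - fst q), 0) else (0, sgn (snd p - snd q)))"
  define q' where "q' = q + s"
  have n: "n = nat (\<bar>fst q' - fst p\<bar> + \<bar>snd q' - snd p\<bar>)"
    using Suc(2) by (auto simp: q'_def s_def sgn_if)
  have less: "\<bar>fst q' - fst p\<bar> + \<bar>snd q' - snd p\<bar> \<le> \<bar>fst q - fst p\<bar> + \<bar>snd q - snd p\<bar>"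
    using n Suc(2) by linarith
  show ?case
  proof (cases "q' \<in> V")
    case True
    have "- s \<in> unit_vectors"
      using Suc(2) by (auto simp: s_def sgn_if unit_vectors_def split: if_splits)
    then have "lattice_dist q' q = 1"
      by (simp add: lattice_dist_one_iff q'_def)
    then have "q' \<in> boundary V"
      using True Suc(4) unfolding boundary_def by blast
    then show ?thesis
      using lattice_dist_le[of p q'] less by (intro bexI[of _ q']) (auto intro: order_trans)
  next
    case False
    then show ?thesis
      using Suc(1)[OF n Suc(3) False] less by (meson of_int_le_iff order_trans)
  qed
qed

section \<open>The tile\<close>

text \<open>The pairs and the rhombi were found by computer search.\<close>

definition tile_pairs :: "(lattice_point \<times> lattice_point) list" where
  "tile_pairs = [((0, -1), (2, -1)), ((0, 1), (0, 0)), ((-2, 2), (-2, 1)), ((-1, 0), (-1, 2)),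
     ((1, 0), (-1, 1)), ((1, 1), (1, -1)), ((0, 2), (2, 0))]"

definition tile_diamonds :: "(lattice_point \<times> lattice_point) list" where
  "tile_diamonds = [((0, -1), (0, 1)), ((2, -1), (-1, 1)), ((0, 1), (1, 0)), ((0, 1), (0, 1)),
     ((0, 1), (-1, 1)), ((0, 0), (1, 0)), ((0, 0), (-1, 1)), ((-2, 1), (1, 0)), ((-1, 0), (1, 0)),
     ((-1, 0), (0, 1)), ((1, 0), (1, 0)), ((1, 0), (0, 1)), ((1, 0), (-1, 1)), ((-1, 1), (1, 0)),
     ((-1, 1), (0, 1)), ((-1, 1), (-1, 1)), ((1, -1), (0, 1)), ((1, -1), (-1, 1))]"

text \<open>Checked by evaluating all 128 choices of one point per pair; lists instead of sets keep
  the statement executable.\<close>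

lemma tile_transversals:
  "\<forall>ts \<in> set (product_lists (map (\<lambda>(p, q). [p, q]) tile_pairs)).
     4 \<le> length (filter (\<lambda>d. 3 \<le> length (filter (\<lambda>p. p \<in> set ts) (diamond d))) tile_diamonds)"
  by code_simp


definition tile :: "lattice_point set" where
  "tile = (\<Union>(p, q)\<in>set tile_pairs. {p, q})"

definition tile_rhombi :: "lattice_point set set" where
  "tile_rhombi = (\<lambda>d. set (diamond d)) ` set tile_diamonds"

text \<open>A list form of the tile, over which bounded quantifiers can be evaluated.\<close>

lemma tile_eq_set: "tile = set (map fst tile_pairs @ map snd tile_pairs)"
  by (force simp: tile_def)

lemma tile_rhombi_subset: "W \<in> tile_rhombi \<Longrightarrow> W \<subseteq> tile"
proof -
  have "\<forall>d\<in>set tile_diamonds. set (diamond d) \<subseteq> set (map fst tile_pairs @ map snd tile_pairs)"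
    by code_simp
  then show "W \<in> tile_rhombi \<Longrightarrow> W \<subseteq> tile"
    by (auto simp: tile_rhombi_def tile_eq_set)
qed

lemma four_tile_rhombi:
  assumes M: "\<forall>(p, q)\<in>set tile_pairs. p \<in> M \<or> q \<in> M"
  shows "4 \<le> card {W \<in> tile_rhombi. 3 \<le> card (W \<inter> M)}"
proof -
  \<comment> \<open>One point of \<open>M\<close> from each pair, so
    \<open>set ts \<subseteq> M\<close>. Further points of \<open>M\<close> can only raise the
    count.\<close>
  define ts where "ts = map (\<lambda>(p, q). if p \<in> M then p else q) tile_pairs"
  define Q where "Q d \<longleftrightarrow> 3 \<le> length (filter (\<lambda>p. p \<in> set ts) (diamond d))" for d
  define S where "S d = set (diamond d)" for d
  have "ts \<in> set (product_lists (map (\<lambda>(p, q). [p, q]) tile_pairs))"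
    by (auto simp: ts_def product_lists_set list_all2_conv_all_nth split: prod.split)
  then have "4 \<le> length (filter Q tile_diamonds)"
    using tile_transversals unfolding Q_def by blast
  also have "\<dots> = card (S ` set (filter Q tile_diamonds))"
  proof -
    \<comment> \<open>The listed diamonds are different as sets, so counting list entries counts
      rhombi.\<close>
    have "distinct (map (\<lambda>d. set (diamond d)) tile_diamonds)" by code_simp
    then have "distinct (map S (filter Q tile_diamonds))"
      unfolding S_def by (rule distinct_map_filter)
    then show ?thesis
      using distinct_card by fastforce
  qed
  also have "\<dots> \<le> card {W \<in> tile_rhombi. 3 \<le> card (W \<inter> M)}"
  proof (rule card_mono)
    show "finite {W \<in> tile_rhombi. 3 \<le> card (W \<inter> M)}"
      by (simp add: tile_rhombi_def)
    have ts: "set ts \<subseteq> M"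
      using M by (auto simp: ts_def)
    \<comment> \<open>No diamond list repeats a point, so the length of a filtered list is a
      cardinality.\<close>
    have dist: "\<forall>d\<in>set tile_diamonds. distinct (diamond d)" by code_simp
    have "3 \<le> card (S d \<inter> M)" if d: "d \<in> set tile_diamonds" "Q d" for d
    proof -
      have "3 \<le> length (filter (\<lambda>p. p \<in> set ts) (diamond d))"
        using d(2) by (simp add: Q_def)
      also have "\<dots> = card (set (filter (\<lambda>p. p \<in> set ts) (diamond d)))"
        using dist d(1) by (intro distinct_card[symmetric]) simp
      also have "\<dots> \<le> card (S d \<inter> M)"
        using ts by (intro card_mono) (auto simp: S_def)
      finally show ?thesis .
    qed
    then show "S ` set (filter Q tile_diamonds) \<subseteq> {W \<in> tile_rhombi. 3 \<le> card (W \<inter> M)}"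
      by (auto simp: tile_rhombi_def S_def)
  qed
  finally show ?thesis .
qed

section \<open>Tiling the lattice\<close>

definition offset :: "int \<times> int \<Rightarrow> lattice_point" where
  "offset = (\<lambda>(i, j). (14 * i + 3 * j, j))"

definition good_blocks :: "lattice_point set \<Rightarrow> (int \<times> int) set" where
  "good_blocks V = {z. (+) (offset z) ` tile \<subseteq> V}"

text \<open>The quotient of the lattice by the sublattice is cyclic of order 14, and this is the
  quotient map: it vanishes on \<open>(14, 0)\<close> and \<open>(3, 1)\<close>.\<close>

definition residue :: "lattice_point \<Rightarrow> int" where
  "residue p = (fst p - 3 * snd p) mod 14"

lemma residue_offset: "residue (offset z + p) = residue p"
proof -
  obtain i j where z: "z = (i, j)" by (cases z)
  have "fst (offset z + p) - 3 * snd (offset z + p) = (fst p - 3 * snd p) + i * 14"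
    by (simp add: z offset_def)
  then show ?thesis
    by (simp only: residue_def mod_mult_self1)
qed

lemma inj_offset: "inj offset"
  by (auto simp: inj_def offset_def)

text \<open>The points of the tile have pairwise different residues, and translation by an
  \<open>offset\<close> preserves residues. Hence different translates are disjoint.\<close>

lemma offset_tile_cancel:
  assumes "p \<in> tile" "q \<in> tile" "offset z + p = offset z' + q"
  shows "z = z'" "p = q"
proof -
  have "\<forall>p\<in>set (map fst tile_pairs @ map snd tile_pairs).
      \<forall>q\<in>set (map fst tile_pairs @ map snd tile_pairs). residue p = residue q \<longrightarrow> p = q"
    by code_simp
  moreover have "residue p = residue q"
    using assms(3) by (metis residue_offset)
  ultimately show "p = q"
    using assms(1,2) unfolding tile_eq_set by blast
  then show "z = z'"
    using assms(3) inj_offset by (simp add: inj_eq)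
qed

lemma finite_good_blocks:
  assumes "finite V"
  shows "finite (good_blocks V)"
proof -
  \<comment> \<open>As the tile contains the origin, \<open>offset\<close> maps good blocks
    injectively into \<open>V\<close>.\<close>
  have "(0, 0) \<in> tile"
    by (simp add: tile_def tile_pairs_def)
  then have "good_blocks V \<subseteq> offset -` V"
    unfolding good_blocks_def by (force simp: zero_prod_def[symmetric])
  then show ?thesis
    using finite_vimageI[OF assms inj_offset] finite_subset by blast
qed

section \<open>The pairing of a board and the score it secures\<close>

definition tile_pairing :: "lattice_point set \<Rightarrow> lattice_point set set" where
  "tile_pairing V = {(+) (offset z) ` {p, q} | z p q. z \<in> good_blocks V \<and> (p, q) \<in> set tile_pairs}"

lemma pairing_tile_pairing: "pairing V (tile_pairing V)"
  unfolding pairing_def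
proof (intro conjI ballI)
  fix e assume "e \<in> tile_pairing V"
  then obtain z p q where e: "e = (+) (offset z) ` {p, q}" "z \<in> good_blocks V" "(p, q) \<in> set tile_pairs"
    by (auto simp: tile_pairing_def)
  have pq: "{p, q} \<subseteq> tile"
    using e(3) by (force simp: tile_def)
  then show "e \<subseteq> V"
    using e(1,2) unfolding good_blocks_def by blast
  have "p \<noteq> q"
    using e(3) by (auto simp: tile_pairs_def)
  then show "card e = 2"
    unfolding e(1) by (subst card_image) auto
next
  show "disjoint (tile_pairing V)"
  proof (rule disjointI)
    fix e e' assume "e \<in> tile_pairing V" "e' \<in> tile_pairing V" and ne: "e \<noteq> e'"
    then obtain z p q z' p' q' where
      e: "e = (+) (offset z) ` {p, q}" "(p, q) \<in> set tile_pairs" and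
      e': "e' = (+) (offset z') ` {p', q'}" "(p', q') \<in> set tile_pairs"
      unfolding tile_pairing_def by blast
    have sub: "{p, q} \<subseteq> tile" "{p', q'} \<subseteq> tile"
      using e(2) e'(2) by (force simp: tile_def)+
    \<comment> \<open>A common point of \<open>e\<close> and \<open>e'\<close> forces the same
      translate and the same tile point, so it remains that different pairs of the tile share no
      point.\<close>
    have disj: "\<forall>x\<in>set tile_pairs. \<forall>y\<in>set tile_pairs. x \<noteq> y \<longrightarrow>
        fst x \<noteq> fst y \<and> fst x \<noteq> snd y \<and> snd x \<noteq> fst y \<and> snd x \<noteq> snd y"
      by code_simp
    have False if x: "x \<in> e" "x \<in> e'" for x
    proof -
      obtain s where s: "x = offset z + s" "s \<in> {p, q}"
        using x(1) unfolding e(1) by (rule imageE)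
      obtain s' where s': "x = offset z' + s'" "s' \<in> {p', q'}"
        using x(2) unfolding e'(1) by (rule imageE)
      have "s \<in> tile" "s' \<in> tile" "offset z + s = offset z' + s'"
        using s s' sub by (blast, blast, simp only:)
      note eqs = offset_tile_cancel[OF this]
      have "(p, q) \<noteq> (p', q')"
        using ne e(1) e'(1) eqs(1) by blast
      then show False
        using disj[rule_format, OF e(2) e'(2)] s(2) s'(2) eqs(2) by auto
    qed
    then show "e \<inter> e' = {}" by blast
  qed
qed

lemma set_diamond_translate: "set (diamond (c + q, u)) = (+) c ` set (diamond (q, u))"
  by (cases c; cases q; cases u) (simp add: diamond_def algebra_simps)

lemma rhombus_translate_tile:
  assumes "W \<in> tile_rhombi"
  shows "rhombus ((+) c ` W)"
proof -
  obtain q u where d: "(q, u) \<in> set tile_diamonds" "W = set (diamond (q, u))"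
    using assms by (auto simp: tile_rhombi_def)
  then have "u \<in> directions"
    by (auto simp: tile_diamonds_def directions_def)
  then show ?thesis
    using d(2) rhombus_diamond set_diamond_translate by metis
qed

text \<open>Maker's set, translated back by the offset of a good block, meets every pair of the
  tile, so each good block contributes four rhombi.\<close>

lemma tile_pairing_guarantees:
  assumes fin: "finite V"
  shows "pairing_guarantees V (rhombi V) 3 (tile_pairing V) (4 * card (good_blocks V))"
  unfolding pairing_guarantees_def
proof (intro allI impI)
  fix \<sigma> \<tau> assume st: "pairing_strategy V (tile_pairing V) \<sigma> \<and> breaker_strategy V \<tau>"
  define M where "M = maker_vertices (play \<sigma> \<tau> (card V))"
  \<comment> \<open>\<open>N z\<close> collects the scoring rhombi in tile coordinates, and
    \<open>A z\<close> is its copy on the board.\<close>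
  define N where "N z = {W \<in> tile_rhombi. 3 \<le> card (W \<inter> (+) (offset z) -` M)}" for z
  define A where "A z = image ((+) (offset z)) ` N z" for z
  have inj: "inj ((+) c)" for c :: lattice_point
    by simp
  have cardA: "4 \<le> card (A z)" if z: "z \<in> good_blocks V" for z
  proof -
    have "p \<in> (+) (offset z) -` M \<or> q \<in> (+) (offset z) -` M" if "(p, q) \<in> set tile_pairs" for p q
    proof -
      have "(+) (offset z) ` {p, q} \<in> tile_pairing V"
        using that z unfolding tile_pairing_def by blast
      then have "(+) (offset z) ` {p, q} \<inter> M \<noteq> {}"
        unfolding M_def using pairing_strategy_hits_pair[OF fin pairing_tile_pairing] st by blast
      then show ?thesis by auto
    qed
    then have "4 \<le> card (N z)"
      unfolding N_def by (intro four_tile_rhombi) auto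
    also have "card (N z) = card (A z)"
      unfolding A_def by (intro card_image[symmetric] inj_on_image inj_on_subset[OF inj]) simp
    finally show ?thesis .
  qed
  have A_block: "W \<subseteq> (+) (offset z) ` tile" "W \<noteq> {}" "rhombus W" "3 \<le> card (W \<inter> M)"
    if "W \<in> A z" for W z
  proof -
    obtain U where U: "U \<in> tile_rhombi" "3 \<le> card (U \<inter> (+) (offset z) -` M)" "W = (+) (offset z) ` U"
      using \<open>W \<in> A z\<close> by (auto simp: A_def N_def)
    show "W \<subseteq> (+) (offset z) ` tile"
      unfolding U(3) using tile_rhombi_subset[OF U(1)] by (rule image_mono)
    show "rhombus W"
      unfolding U(3) using U(1) by (rule rhombus_translate_tile)
    have "W \<inter> M = (+) (offset z) ` (U \<inter> (+) (offset z) -` M)"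
      using U(3) by auto
    then show "3 \<le> card (W \<inter> M)"
      using U(2) by (simp add: card_image)
    then show "W \<noteq> {}" by auto
  qed
  have "4 * card (good_blocks V) = (\<Sum>z\<in>good_blocks V. 4)"
    by simp
  also have "\<dots> \<le> (\<Sum>z\<in>good_blocks V. card (A z))"
    by (intro sum_mono cardA)
  also have "\<dots> = card (\<Union>z\<in>good_blocks V. A z)"
  proof (rule card_UN_disjoint[symmetric])
    show "finite (good_blocks V)" using fin by (rule finite_good_blocks)
    show "\<forall>z\<in>good_blocks V. finite (A z)"
      by (simp add: A_def N_def tile_rhombi_def)
    \<comment> \<open>No rhombus is counted for two blocks: it is nonempty and lies inside its
      translate, and translates are disjoint.\<close>
    have "z = z'" if W: "W \<in> A z" "W \<in> A z'" for z z' W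
    proof -
      obtain x where "x \<in> W" using A_block(2)[OF W(1)] by blast
      then have "x \<in> (+) (offset z) ` tile" "x \<in> (+) (offset z') ` tile"
        using A_block(1)[OF W(1)] A_block(1)[OF W(2)] by (simp_all only: subsetD)
      then obtain p q where p: "p \<in> tile" "x = offset z + p" and q: "q \<in> tile" "x = offset z' + q"
        by blast
      show ?thesis
        by (rule offset_tile_cancel(1)[OF p(1) q(1) trans[OF p(2)[symmetric] q(2)]])
    qed
    then show "\<forall>z\<in>good_blocks V. \<forall>z'\<in>good_blocks V. z \<noteq> z' \<longrightarrow> A z \<inter> A z' = {}"
      by blast
  qed
  also have "\<dots> \<le> score (rhombi V) 3 (play \<sigma> \<tau> (card V))"
    unfolding score_def M_def[symmetric]
  proof (rule card_mono)
    show "finite {W \<in> rhombi V. 3 \<le> card (W \<inter> M)}"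
      using finite_rhombi[OF fin] by simp
    show "(\<Union>z\<in>good_blocks V. A z) \<subseteq> {W \<in> rhombi V. 3 \<le> card (W \<inter> M)}"
    proof (intro UN_least subsetI)
      fix z W assume "z \<in> good_blocks V" "W \<in> A z"
      then show "W \<in> {W \<in> rhombi V. 3 \<le> card (W \<inter> M)}"
        using A_block[of W z] unfolding good_blocks_def rhombi_def by blast
    qed
  qed
  finally show "4 * card (good_blocks V) \<le> score (rhombi V) 3 (play \<sigma> \<tau> (card V))" .
qed

section \<open>Counting rhombi by blocks\<close>

lemma rhombi_in_good_block:
  assumes W: "W \<in> rhombi V"
  shows "W \<in> rhombi_near_boundary V 20 \<or>
    (\<exists>z\<in>good_blocks V. \<exists>r\<in>{0..<14}. \<exists>u\<in>directions. W = set (diamond (offset z + (r, 0), u)))"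
proof -
  obtain q u where u: "u \<in> directions" "W = set (diamond (q, u))"
    using W rhombus_eq_diamond unfolding rhombi_def by blast
  have qW: "q \<in> W"
    unfolding u(2) by (cases q; cases u) (simp add: diamond_def)
  then have qV: "q \<in> V"
    using W by (auto simp: rhombi_def)
  \<comment> \<open>Division by 14 selects the block. The representatives of the classes here are
    \<open>(r, 0)\<close> in a row, not the tile points, so \<open>q\<close> may lie outside the
    translate to which its rhombus is attributed.\<close>
  define z where "z = ((fst q - 3 * snd q) div 14, snd q)"
  define r where "r = residue q"
  have r: "r \<in> {0..<14}"
    by (simp add: r_def residue_def)
  have q: "q = offset z + (r, 0)"
    by (rule prod_eqI) (simp_all add: z_def r_def offset_def residue_def)
  show ?thesis
  proof (cases "z \<in> good_blocks V")
    case True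
    then show ?thesis using u r q by blast
  next
    case False
    then obtain t where t: "t \<in> tile" "offset z + t \<notin> V"
      unfolding good_blocks_def mem_Collect_eq image_subset_iff by blast
    have "\<bar>fst t\<bar> \<le> 2" "\<bar>snd t\<bar> \<le> 2"
      using t(1) by (auto simp: tile_def tile_pairs_def)
    moreover have "0 \<le> r" "r < 14" using r by simp_all
    \<comment> \<open>The coordinate distance is in fact at most \<open>15 + 2\<close>; 20 leaves
      some room.\<close>
    ultimately have "\<bar>fst t - r\<bar> + \<bar>snd t\<bar> \<le> 20" by linarith
    then have "\<bar>fst (offset z + t) - fst q\<bar> + \<bar>snd (offset z + t) - snd q\<bar> \<le> 20"
      by (simp add: q)
    moreover obtain b where "b \<in> boundary V"
      "lattice_dist q b \<le> of_int (\<bar>fst (offset z + t) - fst q\<bar> + \<bar>snd (offset z + t) - snd q\<bar>)"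
      using boundary_between[OF qV t(2)] by blast
    ultimately have "lattice_dist q b \<le> 20" "b \<in> boundary V"
      by linarith+
    then show ?thesis
      using W qW unfolding rhombi_near_boundary_def by blast
  qed
qed

text \<open>The factor 42 is 14 residues times 3 directions. An upper bound only takes a covering:
  the image of the index set is no larger than that set.\<close>

lemma card_rhombi_le:
  assumes fin: "finite V"
  shows "card (rhombi V) \<le> 42 * card (good_blocks V) + card (rhombi_near_boundary V 20)"
proof -
  define D where "D = good_blocks V \<times> {0..<14::int} \<times> directions"
  define f where "f = (\<lambda>(z, r, u). set (diamond (offset z + (r, 0), u)))"
  have D: "finite D"
    unfolding D_def directions_def using finite_good_blocks[OF fin] by auto
  have "rhombi V \<subseteq> f ` D \<union> rhombi_near_boundary V 20"
    using rhombi_in_good_block[of _ V] unfolding f_def D_def by fastforce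
  moreover have "finite (rhombi_near_boundary V 20)"
    using finite_rhombi[OF fin] by (simp add: rhombi_near_boundary_def)
  ultimately have "card (rhombi V) \<le> card (f ` D \<union> rhombi_near_boundary V 20)"
    using D by (intro card_mono) auto
  also have "\<dots> \<le> card (f ` D) + card (rhombi_near_boundary V 20)"
    by (rule card_Un_le)
  also have "card (f ` D) \<le> card D"
    using D by (rule card_image_le)
  also have "card D = 42 * card (good_blocks V)"
    by (simp add: D_def directions_def card_cartesian_product)
  finally show ?thesis by simp
qed

theorem theorem16:
  fixes V :: "nat \<Rightarrow> lattice_point set"
  assumes "\<And>i. finite (V i)"
    and "filterlim (\<lambda>i. card (rhombi (V i))) at_top sequentially"
    and "two_dimensional V"
  shows "\<exists>err :: nat \<Rightarrow> real. err \<in> o(\<lambda>i. real (card (rhombi (V i)))) \<and>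
    (\<forall>i. real (SC2 (V i) (rhombi (V i)) 3) \<ge> 7 * real (card (rhombi (V i))) / 96 - err i)"
proof (intro exI conjI allI)
  \<comment> \<open>With \<open>n\<close> rhombi, \<open>b\<close> of them near the boundary, and
    \<open>g\<close> good blocks, \<open>n \<le> 42 * g + b\<close> gives
    \<open>7 / 96 * (n - b) \<le> 7 / 96 * 42 * g \<le> 4 * g\<close>, as
    \<open>7 * 42 / 96 < 4\<close>. Two-dimensionality at distance 20 makes the term in
    \<open>b\<close> negligible.\<close>
  let ?err = "\<lambda>i. 7 / 96 * real (card (rhombi_near_boundary (V i) 20))"
  show "?err \<in> o(\<lambda>i. real (card (rhombi (V i))))"
    using assms(3) by (simp add: two_dimensional_def)
  fix i
  have "4 * card (good_blocks (V i)) \<le> SC2 (V i) (rhombi (V i)) 3"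
    by (rule SC2_ge[OF finite_rhombi[OF assms(1)] pairing_tile_pairing
          tile_pairing_guarantees[OF assms(1)]])
  moreover have "card (rhombi (V i)) \<le> 42 * card (good_blocks (V i)) + card (rhombi_near_boundary (V i) 20)"
    by (rule card_rhombi_le[OF assms(1)])
  ultimately show "real (SC2 (V i) (rhombi (V i)) 3) \<ge> 7 * real (card (rhombi (V i))) / 96 - ?err i"
    by linarith
qed

end
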